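(* Let $k$ be a positive integer and let $p$ be a prime number such that $p\equiv 5\pmod 6$. Then for every integer $n\ge 0$, $$B_3\left(p^{2k}n+\frac{p^{2k}-1}{6}\right)\equiv(-p)^k\cdot B_3(n)\pmod 3.$$
   Context: A partition is called $3$-regular if none of its parts is divisible by $3$. $B_3(n)$ denotes the number of ordered pairs $(\lambda,\mu)$ of $3$-regular partitions such that the sum of all parts of $\lambda$ and $\mu$ equals $n$ (so $B_3(0)=1$); equivalently $\sum_{n\ge 0}B_3(n)q^n=\prod_{k\ge1}\frac{(1-q^{3k})^2}{(1-q^k)^2}$. *)

theory Defs
  imports "HOL-Library.Multiset" "HOL-Number_Theory.Number_Theory"
begin

definition is_partition :: "nat multiset \<Rightarrow> bool" where
  "is_partition \<alpha> \<longleftrightarrow> (\<forall>x\<in>#\<alpha>. x > 0)"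

definition regular_partition :: "nat \<Rightarrow> nat multiset \<Rightarrow> bool" where
  "regular_partition l \<alpha> \<longleftrightarrow> is_partition \<alpha> \<and> (\<forall>x\<in>#\<alpha>. \<not> l dvd x)"

definition regular_bipartitions :: "nat \<Rightarrow> nat \<Rightarrow> (nat multiset \<times> nat multiset) set" where
  "regular_bipartitions l n =
     {(\<alpha>, \<beta>). regular_partition l \<alpha> \<and> regular_partition l \<beta> \<and> sum_mset \<alpha> + sum_mset \<beta> = n}"

definition B3 :: "nat \<Rightarrow> nat" where
  "B3 n = card (regular_bipartitions 3 n)"

text \<open>The sets counted by \<open>B3\<close> are finite, so that \<open>card\<close> is a genuine count.\<close>

lemma size_le_sum_mset_partition: "is_partition \<alpha> \<Longrightarrow> size \<alpha> \<le> sum_mset \<alpha>"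
  by (induction \<alpha>) (auto simp: is_partition_def)

lemma finite_regular_bipartitions: "finite (regular_bipartitions l n)"
proof -
  let ?S = "\<Union>s\<le>n. multisets_of_size {..n} s"
  have fin: "finite ?S"
    by auto
  have "\<alpha> \<in> ?S" if "is_partition \<alpha>" "sum_mset \<alpha> \<le> n" for \<alpha> :: "nat multiset"
  proof -
    have "x \<le> n" if "x \<in># \<alpha>" for x
      using \<open>sum_mset \<alpha> \<le> n\<close> by (auto simp: sum_mset.remove[OF that])
    moreover have "size \<alpha> \<le> n"
      using size_le_sum_mset_partition that by fastforce
    ultimately show ?thesis by (auto simp: multisets_of_size_def)
  qed
  hence "regular_bipartitions l n \<subseteq> ?S \<times> ?S"
    unfolding regular_bipartitions_def regular_partition_def by fastforce
  thus ?thesis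
    using fin finite_subset by blast
qed

lemma B3_0: "B3 0 = 1"
proof -
  have "regular_bipartitions 3 0 = {({#}, {#})}"
  proof -
    have "\<alpha> = {#}" if "is_partition \<alpha>" "sum_mset \<alpha> = 0" for \<alpha> :: "nat multiset"
      using size_le_sum_mset_partition[OF that(1)] that(2) by simp
    thus ?thesis
      by (auto simp: regular_bipartitions_def regular_partition_def is_partition_def)
  qed
  thus ?thesis by (simp add: B3_def)
qed

end

theory Submission
  imports Defs "HOL-Computational_Algebra.Formal_Power_Series" "HOL-Library.Nat_Bijection"
begin

text \<open>Modulo 3 the generating function of \<open>B3\<close> is \<open>f(q) f(q\<^sup>3)\<close> with \<open>f(q) = \<Prod>(1 - q\<^sup>k)\<close>, because
  \<open>f(q\<^sup>3) \<equiv> f(q)\<^sup>3\<close>. By the pentagonal number theorem \<open>B3 n\<close> is thus congruent to a signed count of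
  the solutions of \<open>x\<^sup>2 + 3 y\<^sup>2 = 24 n + 4\<close> with \<open>x \<equiv> y \<equiv> -1 (mod 6)\<close>. Replacing \<open>n\<close> by
  \<open>p\<^sup>2 n + (p\<^sup>2 - 1) / 6\<close> multiplies the right-hand side by \<open>p\<^sup>2\<close>. As \<open>p\<close> is inert in \<open>\<rat>(\<surd>-3)\<close>, all
  solutions of the new equation are multiples by \<open>- p\<close> of solutions of the old one, and the two signs
  change simultaneously. Hence \<open>B3\<close> takes congruent values, while \<open>- p \<equiv> 1 (mod 3)\<close>.\<close>

section \<open>The pentagonal number theorem\<close>

text \<open>The truncated Euler function. The base \<open>q\<close> is generic so that both
  \<open>fps_X\<close> and \<open>fps_X ^ 3\<close> can be substituted.\<close>

definition euler_prod :: "'a::comm_ring_1 \<Rightarrow> nat \<Rightarrow> 'a" where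
  "euler_prod q n = (\<Prod>i\<in>{1..n}. 1 - q ^ i)"

text \<open>Generalized pentagonal numbers 0, 1, 2, 5, 7, ... for j = 0, 1, -1, 2, -2, ...; the
  product is even and nonnegative, so \<open>div\<close> and \<open>nat\<close> lose
  nothing.\<close>

definition pentagonal :: "int \<Rightarrow> nat" where
  "pentagonal j = nat (j * (3 * j - 1) div 2)"

lemma pentagonal_square: "24 * int (pentagonal j) + 1 = (6 * j - 1)\<^sup>2"
proof -
  have "even (j * (3 * j - 1))" by auto
  moreover have "j * (3 * j - 1) \<ge> 0"
    by (cases "j \<ge> 1") (auto intro: mult_nonneg_nonneg mult_nonpos_nonpos)
  ultimately have "2 * int (pentagonal j) = j * (3 * j - 1)"
    unfolding pentagonal_def by auto
  thus ?thesis by (simp add: power2_eq_square algebra_simps)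
qed

text \<open>This confines the indices of all representations of \<open>n\<close> to the window from
  \<open>- n\<close> to \<open>n\<close> over which the finite identity below sums.\<close>

lemma abs_le_pentagonal: "\<bar>j\<bar> \<le> int (pentagonal j)"
proof -
  have "24 * \<bar>j\<bar> + 1 \<le> (6 * j - 1)\<^sup>2"
  proof (cases "j \<ge> 1")
    case True
    hence "36 * (j * (j - 1)) \<ge> 0" by simp
    thus ?thesis using True by (simp add: power2_eq_square algebra_simps)
  next
    case False
    hence "j * (j + 1) \<ge> 0"
      by (cases "j = 0") (auto intro: mult_nonpos_nonpos)
    thus ?thesis using False by (simp add: power2_eq_square algebra_simps)
  qed
  thus ?thesis using pentagonal_square[of j] by linarith
qed

text \<open>These are the two exponents that arise when \<open>n\<close> grows by one in Shanks'
  identity.\<close>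

lemma pentagonal_Suc:
  "pentagonal (int (Suc n)) = Suc n * n + triangle (Suc n)"
  "pentagonal (- int (Suc n)) = Suc n * Suc n + triangle (Suc n)"
proof -
  have *: "2 * int (triangle (Suc n)) = (int n + 1) * (int n + 2)"
    by (induction n) (auto simp: algebra_simps)
  have "24 * int (pentagonal (int (Suc n))) = 24 * int (Suc n * n + triangle (Suc n))"
    using pentagonal_square[of "int (Suc n)"] *
    by (simp add: power2_eq_square algebra_simps del: triangle_Suc)
  thus "pentagonal (int (Suc n)) = Suc n * n + triangle (Suc n)"
    by (simp only: mult_cancel_left of_nat_eq_iff) simp
  have "24 * int (pentagonal (- int (Suc n))) = 24 * int (Suc n * Suc n + triangle (Suc n))"
    using pentagonal_square[of "- int (Suc n)"] *
    by (simp add: power2_eq_square algebra_simps del: triangle_Suc)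
  thus "pentagonal (- int (Suc n)) = Suc n * Suc n + triangle (Suc n)"
    by (simp only: mult_cancel_left of_nat_eq_iff) simp
qed

text \<open>Shanks' finite form of the pentagonal number theorem; only the term \<open>s = 0\<close> on the
  left survives modulo \<open>q ^ Suc n\<close>.\<close>

lemma shanks:
  fixes q :: "'a::comm_ring_1"
  shows "(\<Sum>s\<le>n. (-1) ^ s * (\<Prod>i\<in>{s<..n}. 1 - q ^ i) * q ^ (s * n + triangle s))
       = (\<Sum>j\<in>{- int n..int n}. (-1) ^ nat \<bar>j\<bar> * q ^ pentagonal j)"
proof (induction n)
  case 0
  show ?case by (simp add: pentagonal_def)
next
  case (Suc n)
  define A where "A s = (\<Prod>i\<in>{s<..n}. 1 - q ^ i)" for s
  define T where "T s = (-1) ^ s * A s * q ^ (s * n + triangle s)" for s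
  define T' where "T' s = (-1) ^ s * (\<Prod>i\<in>{s<..Suc n}. 1 - q ^ i) * q ^ (s * Suc n + triangle s)" for s
  \<comment> \<open>Telescoping certificate for \<open>T' s - T s\<close>. Its value at 0 is set
    apart because \<open>A (0 - 1)\<close> would truncate to \<open>A 0\<close>.\<close>
  define U where "U s = (if s = 0 then 0 else (-1) ^ s * A (s - 1) * q ^ (s * n + triangle s))" for s
  have "T' s - T s = U (Suc s) - U s" if "s \<le> n" for s
  proof -
    have "{s<..Suc n} = insert (Suc n) {s<..n}" using that by auto
    hence T': "T' s = (-1) ^ s * (A s * (1 - q ^ Suc n)) * (q ^ s * q ^ (s * n + triangle s))"
      unfolding T'_def A_def by (simp add: power_add[symmetric] algebra_simps)
    have U': "U (Suc s) = - ((-1) ^ s * A s * (q ^ Suc n * q ^ s * q ^ (s * n + triangle s)))"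
      unfolding U_def by (simp add: power_add[symmetric] algebra_simps)
    have Us: "U s = (-1) ^ s * (A s * (1 - q ^ s)) * q ^ (s * n + triangle s)"
    proof (cases s)
      case (Suc r)
      have "{r<..n} = insert s {s<..n}" using that Suc by auto
      hence "A r = A s * (1 - q ^ s)" unfolding A_def by simp
      thus ?thesis using Suc unfolding U_def by simp
    qed (simp add: U_def)
    show ?thesis unfolding T' U' T_def Us by (simp add: algebra_simps)
  qed
  hence "(\<Sum>s\<le>n. T' s) - (\<Sum>s\<le>n. T s) = (\<Sum>s\<le>n. U (Suc s) - U s)"
    by (simp add: sum_subtractf[symmetric])
  also have "\<dots> = U (Suc n)"
    using sum_lessThan_telescope[of U "Suc n"] by (simp add: lessThan_Suc_atMost U_def)
  \<comment> \<open>The boundary term of the telescoping sum supplies the new index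
    \<open>int (Suc n)\<close>; the extra summand \<open>T' (Suc n)\<close> supplies
    \<open>- int (Suc n)\<close>.\<close>
  also have "\<dots> = (-1) ^ Suc n * q ^ pentagonal (int (Suc n))"
    unfolding pentagonal_Suc U_def A_def by simp
  finally have 1: "(\<Sum>s\<le>n. T' s) = (\<Sum>s\<le>n. T s) + (-1) ^ Suc n * q ^ pentagonal (int (Suc n))"
    by (simp add: algebra_simps)
  have 2: "T' (Suc n) = (-1) ^ Suc n * q ^ pentagonal (- int (Suc n))"
    unfolding pentagonal_Suc T'_def by simp
  have "{- int (Suc n)..int (Suc n)} = insert (int (Suc n)) (insert (- int (Suc n)) {- int n..int n})"
    by auto
  hence "(\<Sum>j\<in>{- int (Suc n)..int (Suc n)}. (-1) ^ nat \<bar>j\<bar> * q ^ pentagonal j)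
      = (-1) ^ Suc n * q ^ pentagonal (int (Suc n)) + ((-1) ^ Suc n * q ^ pentagonal (- int (Suc n))
        + (\<Sum>j\<in>{- int n..int n}. (-1) ^ nat \<bar>j\<bar> * q ^ pentagonal j))"
    by (simp add: nat_add_distrib del: of_nat_Suc)
  also have "\<dots> = (\<Sum>s\<le>Suc n. T' s)"
    using 1 2 Suc.IH by (simp add: T_def A_def algebra_simps)
  finally show ?case unfolding T'_def by simp
qed

lemma euler_prod_pentagonal:
  fixes q :: "'a::comm_ring_1"
  shows "q ^ Suc n dvd (\<Sum>j\<in>{- int n..int n}. (-1) ^ nat \<bar>j\<bar> * q ^ pentagonal j) - euler_prod q n"
proof -
  let ?t = "\<lambda>s. (-1) ^ s * (\<Prod>i\<in>{s<..n}. 1 - q ^ i) * q ^ (s * n + triangle s)"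
  have "{0<..n} = {1..n}" by auto
  hence "?t 0 = euler_prod q n"
    by (simp add: euler_prod_def)
  moreover have "{..n} = insert 0 {1..n}" by auto
  ultimately have "(\<Sum>s\<le>n. ?t s) = euler_prod q n + (\<Sum>s\<in>{1..n}. ?t s)"
    by simp
  moreover have "q ^ Suc n dvd (\<Sum>s\<in>{1..n}. ?t s)"
  proof (rule dvd_sum)
    fix s assume "s \<in> {1..n}"
    then obtain r where "s = Suc r" by (cases s) auto
    hence "Suc n \<le> s * n + triangle s" by simp
    thus "q ^ Suc n dvd ?t s" by (intro dvd_mult le_imp_power_dvd)
  qed
  ultimately show ?thesis unfolding shanks[symmetric] by simp
qed

lemma euler_prod_extend:
  fixes q :: "'a::comm_ring_1"
  shows "q ^ Suc n dvd euler_prod q (n + k) - euler_prod q n"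
proof (induction k)
  case (Suc k)
  have "euler_prod q (n + Suc k) = euler_prod q (n + k) - euler_prod q (n + k) * q ^ Suc (n + k)"
    by (simp add: euler_prod_def algebra_simps)
  hence "euler_prod q (n + Suc k) - euler_prod q n
      = (euler_prod q (n + k) - euler_prod q n) - euler_prod q (n + k) * q ^ Suc (n + k)"
    by simp
  moreover have "q ^ Suc n dvd euler_prod q (n + k) * q ^ Suc (n + k)"
    by (intro dvd_mult le_imp_power_dvd) simp
  ultimately show ?case using Suc.IH by (metis dvd_diff)
qed simp

section \<open>Truncated congruences of power series\<close>

text \<open>Congruence modulo the ideal generated by \<open>m\<close> and \<open>fps_X ^ N\<close>;
  finite products can then stand in for infinite ones.\<close>

definition fps_cong :: "int \<Rightarrow> nat \<Rightarrow> int fps \<Rightarrow> int fps \<Rightarrow> bool" where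
  "fps_cong m N f g \<longleftrightarrow> (\<forall>i<N. [fps_nth f i = fps_nth g i] (mod m))"

lemma fps_cong_refl [simp]: "fps_cong m N f f"
  by (simp add: fps_cong_def)

lemma fps_cong_sym: "fps_cong m N f g \<Longrightarrow> fps_cong m N g f"
  by (simp add: fps_cong_def cong_sym)

lemma fps_cong_trans [trans]: "fps_cong m N f g \<Longrightarrow> fps_cong m N g h \<Longrightarrow> fps_cong m N f h"
  unfolding fps_cong_def using cong_trans by blast

lemma fps_cong_mult: "fps_cong m N f g \<Longrightarrow> fps_cong m N f' g' \<Longrightarrow> fps_cong m N (f * f') (g * g')"
  unfolding fps_cong_def fps_mult_nth by (auto intro!: cong_sum cong_mult)

text \<open>A series with constant term 1 is a unit over the integers, so multiplying by its inverse
  keeps the congruence.\<close>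

lemma fps_cong_cancel:
  assumes "fps_cong m N (c * f) (c * g)" and "fps_nth c 0 = 1"
  shows "fps_cong m N f g"
proof -
  obtain d where d: "c * d = 1"
    using fps_right_inverse[of c 1] assms(2) by auto
  hence "d * (c * h) = h" for h
    by (simp only: mult.assoc[symmetric] mult.commute[of d c] mult_1_left)
  thus ?thesis using fps_cong_mult[OF fps_cong_refl[of m N d] assms(1)] by metis
qed

lemma fps_cong_if_X_power_dvd:
  assumes "fps_X ^ N dvd f - g"
  shows "fps_cong m N f g"
proof -
  obtain h where h: "f - g = fps_X ^ N * h" using assms by (rule dvdE)
  have "fps_nth f i = fps_nth g i" if "i < N" for i
    using arg_cong[OF h, of "\<lambda>f. fps_nth f i"] that by (simp add: fps_X_power_mult_nth)
  thus ?thesis by (simp add: fps_cong_def)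
qed

lemma fps_cong_if_dvd:
  assumes "fps_const m dvd f - g"
  shows "fps_cong m N f g"
proof -
  obtain h where h: "f - g = fps_const m * h" using assms by (rule dvdE)
  have "fps_nth f i - fps_nth g i = m * fps_nth h i" for i
    using arg_cong[OF h, of "\<lambda>f. fps_nth f i"] by simp
  thus ?thesis by (simp add: fps_cong_def cong_iff_dvd_diff)
qed

text \<open>Frobenius, factor by factor: the mixed terms of the cube of \<open>1 - x\<close> are
  divisible by 3.\<close>

lemma euler_prod_frobenius:
  "fps_cong 3 N (euler_prod q n ^ 3) (euler_prod (q ^ 3) n)"
proof (induction n)
  case (Suc n)
  have "(1 - x) ^ 3 - (1 - x ^ 3) = fps_const 3 * (x ^ 2 - x)" for x :: "int fps"
    by (simp add: numeral_fps_const[symmetric] power3_eq_cube power2_eq_square algebra_simps)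
  hence "fps_cong 3 N ((1 - x) ^ 3) (1 - x ^ 3)" for x
    by (intro fps_cong_if_dvd) simp
  from this[of "q ^ Suc n"] fps_cong_mult[OF Suc.IH]
  have "fps_cong 3 N (euler_prod q n ^ 3 * (1 - q ^ Suc n) ^ 3)
      (euler_prod (q ^ 3) n * (1 - (q ^ Suc n) ^ 3))"
    by blast
  moreover have "euler_prod q (Suc n) ^ 3 = euler_prod q n ^ 3 * (1 - q ^ Suc n) ^ 3"
    by (simp add: euler_prod_def power_mult_distrib)
  moreover have "(q ^ 3) ^ Suc n = (q ^ Suc n) ^ 3"
    by (metis power_mult mult.commute)
  hence "euler_prod (q ^ 3) (Suc n) = euler_prod (q ^ 3) n * (1 - (q ^ Suc n) ^ 3)"
    by (simp add: euler_prod_def del: power_Suc)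
  ultimately show ?case by simp
qed (simp add: euler_prod_def)

section \<open>Generating functions of partitions\<close>

definition partitions_in :: "nat set \<Rightarrow> nat \<Rightarrow> nat multiset set" where
  "partitions_in A n = {M. set_mset M \<subseteq> A \<and> sum_mset M = n}"

definition partitions_fps :: "nat set \<Rightarrow> int fps" where
  "partitions_fps A = Abs_fps (\<lambda>n. int (card (partitions_in A n)))"

lemma finite_partitions_in:
  assumes "finite A" "0 \<notin> A"
  shows "finite (partitions_in A n)"
proof (rule finite_subset)
  show "partitions_in A n \<subseteq> (\<Union>s\<le>n. multisets_of_size A s)"
  proof
    fix M assume "M \<in> partitions_in A n"
    hence M: "set_mset M \<subseteq> A" "sum_mset M = n" by (auto simp: partitions_in_def)
    hence "is_partition M" unfolding is_partition_def using assms(2) by (metis gr0I subsetD)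
    thus "M \<in> (\<Union>s\<le>n. multisets_of_size A s)"
      using size_le_sum_mset_partition[of M] M by (auto simp: multisets_of_size_def)
  qed
qed (use assms in auto)

text \<open>Split by whether \<open>a\<close> occurs. If so, remove one copy; further copies may
  remain, hence \<open>insert a A\<close> on the right as well.\<close>

lemma partitions_in_insert:
  assumes "a \<notin> A" "a \<le> n"
  shows "partitions_in (insert a A) n = partitions_in A n \<union> add_mset a ` partitions_in (insert a A) (n - a)"
proof (intro equalityI subsetI)
  fix M assume M: "M \<in> partitions_in (insert a A) n"
  show "M \<in> partitions_in A n \<union> add_mset a ` partitions_in (insert a A) (n - a)"
  proof (cases "a \<in># M")
    case True
    then obtain K where "M = add_mset a K" by (metis insert_DiffM)
    thus ?thesis using M by (auto simp: partitions_in_def)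
  next
    case False
    thus ?thesis using M by (auto simp: partitions_in_def)
  qed
qed (use assms in \<open>auto simp: partitions_in_def\<close>)

lemma partitions_fps_insert:
  assumes "finite A" "0 \<notin> A" "a \<notin> A" "a > 0"
  shows "partitions_fps (insert a A) * (1 - fps_X ^ a) = partitions_fps A"
proof (rule fps_ext)
  fix n
  have fin: "finite (partitions_in A m)" "finite (partitions_in (insert a A) m)" for m
    using assms by (auto intro!: finite_partitions_in)
  have "int (card (partitions_in (insert a A) n))
      = int (card (partitions_in A n)) + (if n < a then 0 else int (card (partitions_in (insert a A) (n - a))))"
  \<comment> \<open>For \<open>n < a\<close> the difference \<open>n - a\<close> would truncate to
    0, but a part \<open>a\<close> cannot fit into the sum at all.\<close>
  proof (cases "n < a")
    case True
    have "M \<in> partitions_in (insert a A) n \<longleftrightarrow> M \<in> partitions_in A n" for M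
    proof (cases "a \<in># M")
      case in_M: True
      then obtain K where "M = add_mset a K" by (metis insert_DiffM)
      hence "a \<le> sum_mset M" by simp
      hence "sum_mset M \<noteq> n" using True by linarith
      thus ?thesis by (simp add: partitions_in_def)
    next
      case False
      thus ?thesis by (simp add: partitions_in_def subset_insert)
    qed
    hence "partitions_in (insert a A) n = partitions_in A n" by (simp add: set_eq_iff)
    thus ?thesis using True by simp
  next
    case False
    have "a \<notin># M" if "M \<in> partitions_in A n" for M
      using that assms(3) unfolding partitions_in_def by blast
    hence "partitions_in A n \<inter> add_mset a ` partitions_in (insert a A) (n - a) = {}"
      by fastforce
    hence "card (partitions_in (insert a A) n)
      = card (partitions_in A n) + card (add_mset a ` partitions_in (insert a A) (n - a))"
      using assms(3) False fin by (subst partitions_in_insert) (simp_all add: card_Un_disjoint)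
    also have "card (add_mset a ` partitions_in (insert a A) (n - a)) = card (partitions_in (insert a A) (n - a))"
      by (rule card_image) (auto intro: inj_onI)
    finally show ?thesis using False by simp
  qed
  thus "fps_nth (partitions_fps (insert a A) * (1 - fps_X ^ a)) n = fps_nth (partitions_fps A) n"
    by (simp add: partitions_fps_def right_diff_distrib fps_X_power_mult_right_nth)
qed

lemma partitions_fps_mult_prod:
  assumes "finite A" "0 \<notin> A"
  shows "partitions_fps A * (\<Prod>a\<in>A. 1 - fps_X ^ a) = 1"
  using assms
proof (induction A rule: finite_induct)
  case empty
  have "partitions_in {} n = (if n = 0 then {{#}} else {})" for n
    by (auto simp: partitions_in_def)
  hence "partitions_fps {} = 1"
    by (intro fps_ext) (simp add: partitions_fps_def)
  thus ?case by simp
next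
  case (insert a A)
  have "partitions_fps (insert a A) * (\<Prod>b\<in>insert a A. 1 - fps_X ^ b)
      = (partitions_fps (insert a A) * (1 - fps_X ^ a)) * (\<Prod>b\<in>A. 1 - fps_X ^ b)"
    using insert.hyps by (simp add: mult.assoc)
  also have "\<dots> = partitions_fps A * (\<Prod>b\<in>A. 1 - fps_X ^ b)"
    using insert by (subst partitions_fps_insert) auto
  also have "\<dots> = 1" using insert by simp
  finally show ?case .
qed

text \<open>Parts never exceed the sum, so a finite set of admissible parts suffices up to degree
  \<open>N\<close>; sorting pairs by the sum of the first component gives the Cauchy
  product.\<close>

lemma card_regular_bipartitions_fps:
  assumes "n \<le> N" "l > 0"
  defines "A \<equiv> {k\<in>{1..N}. \<not> l dvd k}"
  shows "int (card (regular_bipartitions l n)) = fps_nth (partitions_fps A * partitions_fps A) n"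
proof -
  have fin: "finite (partitions_in A m)" for m
    by (rule finite_partitions_in) (auto simp: A_def)
  have *: "regular_partition l M \<longleftrightarrow> M \<in> partitions_in A (sum_mset M)" if "sum_mset M \<le> n" for M
  proof -
    have "x \<le> N" if "x \<in># M" for x
      using \<open>sum_mset M \<le> n\<close> assms(1) by (auto simp: sum_mset.remove[OF that])
    thus ?thesis
      by (force simp: regular_partition_def is_partition_def partitions_in_def A_def)
  qed
  have "regular_bipartitions l n = (\<Union>i\<in>{0..n}. partitions_in A i \<times> partitions_in A (n - i))"
    (is "_ = ?R")
  proof (intro equalityI subsetI)
    fix z assume z: "z \<in> regular_bipartitions l n"
    obtain \<alpha> \<beta> where "z = (\<alpha>, \<beta>)" by fastforce
    with z have "z = (\<alpha>, \<beta>)" "regular_partition l \<alpha>" "regular_partition l \<beta>" "sum_mset \<alpha> + sum_mset \<beta> = n"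
      by (auto simp: regular_bipartitions_def)
    thus "z \<in> ?R" using *[of \<alpha>] *[of \<beta>]
      by (intro UN_I[of "sum_mset \<alpha>"]) auto
  next
    fix z assume "z \<in> ?R"
    then obtain i \<alpha> \<beta> where z: "i \<le> n" "z = (\<alpha>, \<beta>)" "\<alpha> \<in> partitions_in A i" "\<beta> \<in> partitions_in A (n - i)"
      by auto
    hence "sum_mset \<alpha> = i" "sum_mset \<beta> = n - i" by (auto simp: partitions_in_def)
    thus "z \<in> regular_bipartitions l n" using z *[of \<alpha>] *[of \<beta>]
      by (auto simp: regular_bipartitions_def)
  qed
  moreover have "card ?R = (\<Sum>i\<in>{0..n}. card (partitions_in A i \<times> partitions_in A (n - i)))"
    using fin by (intro card_UN_disjoint) (auto simp: partitions_in_def)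
  ultimately show ?thesis
    by (simp add: fps_mult_nth partitions_fps_def card_cartesian_product)
qed

section \<open>The residue of \<open>B3\<close> modulo 3\<close>

text \<open>The bound \<open>3 * M\<close> makes the multiples of 3 in range exactly three times the
  numbers from 1 to \<open>M\<close>.\<close>

lemma euler_prod_regular:
  fixes q :: "'a::comm_ring_1"
  shows "(\<Prod>a\<in>{k\<in>{1..3 * M}. \<not> 3 dvd k}. 1 - q ^ a) * euler_prod (q ^ 3) M = euler_prod q (3 * M)"
proof -
  have "euler_prod (q ^ 3) M = (\<Prod>k\<in>{1..M}. 1 - q ^ (3 * k))"
    by (simp add: euler_prod_def power_mult)
  also have "\<dots> = (\<Prod>a\<in>(\<lambda>k. 3 * k) ` {1..M}. 1 - q ^ a)"
    by (simp add: prod.reindex inj_on_def)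
  also have "(\<lambda>k. 3 * k) ` {1..M} = {k\<in>{1..3 * M}. 3 dvd k}"
    by (auto elim!: dvdE)
  finally have "euler_prod (q ^ 3) M = (\<Prod>a\<in>{k\<in>{1..3 * M}. 3 dvd k}. 1 - q ^ a)" .
  moreover have "{k\<in>{1..3 * M}. \<not> 3 dvd k} \<union> {k\<in>{1..3 * M}. 3 dvd k} = {1..3 * M}" by auto
  ultimately show ?thesis
    using prod.union_disjoint[of "{k\<in>{1..3 * M}. \<not> 3 dvd k}" "{k\<in>{1..3 * M}. 3 dvd k}" "\<lambda>a. 1 - q ^ a"]
    unfolding euler_prod_def[of q] by fastforce
qed

text \<open>With the names of the proof, \<open>G * P' = Q\<close> exactly and \<open>Q\<close> is
  congruent to \<open>P ^ 3\<close>. Thus \<open>P'\<close> squared times \<open>G\<close> squared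
  is congruent to \<open>P ^ 3 * Q\<close>; as \<open>P\<close> and \<open>P'\<close> agree up to
  degree \<open>M\<close>, cancelling \<open>P'\<close> squared leaves \<open>P * Q\<close>.\<close>

lemma B3_cong_euler_prod:
  assumes "n \<le> M"
  shows "[int (B3 n) = fps_nth (euler_prod fps_X M * euler_prod (fps_X ^ 3) M) n] (mod 3)"
proof -
  define A where "A = {k\<in>{1..3 * M}. \<not> 3 dvd k}"
  define G where "G = partitions_fps A"
  define P where "P = (euler_prod fps_X M :: int fps)"
  define P' where "P' = (euler_prod fps_X (3 * M) :: int fps)"
  define Q where "Q = (euler_prod (fps_X ^ 3) M :: int fps)"
  let ?c = "fps_cong 3 (Suc M)"
  have "G * P' = G * (\<Prod>a\<in>A. 1 - fps_X ^ a) * Q"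
    unfolding P'_def Q_def A_def euler_prod_regular[symmetric] by (simp add: mult.assoc)
  also have "\<dots> = Q"
    unfolding G_def by (subst partitions_fps_mult_prod) (auto simp: A_def)
  finally have GP': "G * P' = Q" .
  have P'P: "?c P' P"
    using euler_prod_extend[of fps_X M "2 * M"]
    unfolding P'_def P_def by (intro fps_cong_if_X_power_dvd) simp
  have "(P' * P') * (G * G) = Q * Q"
    unfolding GP'[symmetric] by (simp add: algebra_simps)
  also have "?c (Q * Q) (P ^ 3 * Q)"
    unfolding Q_def P_def by (intro fps_cong_mult fps_cong_refl fps_cong_sym[OF euler_prod_frobenius])
  also have "P ^ 3 * Q = (P * P) * (P * Q)"
    by (simp add: power3_eq_cube algebra_simps)
  also have "?c \<dots> ((P' * P') * (P * Q))"
    by (intro fps_cong_mult fps_cong_refl fps_cong_sym[OF P'P])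
  finally have "?c ((P' * P') * (G * G)) ((P' * P') * (P * Q))" .
  moreover have "fps_nth (P' * P') 0 = 1"
    unfolding P'_def euler_prod_def by (simp add: fps_prod_nth')
  ultimately have "?c (G * G) (P * Q)"
    by (rule fps_cong_cancel)
  thus ?thesis
    using card_regular_bipartitions_fps[of n "3 * M" 3] assms
    unfolding fps_cong_def B3_def G_def A_def P_def Q_def by simp
qed

definition sum_of_pentagonals :: "nat \<Rightarrow> (int \<times> int) set" where
  "sum_of_pentagonals n = {(i, j). pentagonal i + 3 * pentagonal j = n}"

text \<open>Multiplying by 24 and adding 1 + 3 completes both squares.\<close>

lemma sum_of_pentagonals_iff:
  "(i, j) \<in> sum_of_pentagonals n \<longleftrightarrow> (6 * i - 1)\<^sup>2 + 3 * (6 * j - 1)\<^sup>2 = 24 * int n + 4"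
  unfolding sum_of_pentagonals_def pentagonal_square[symmetric] by auto

lemma B3_cong_sum:
  "[int (B3 n) = (\<Sum>(i, j)\<in>sum_of_pentagonals n. (-1) ^ nat \<bar>i\<bar> * (-1) ^ nat \<bar>j\<bar>)] (mod 3)"
proof -
  let ?I = "{- int n..int n}"
  define S where "S q = (\<Sum>j\<in>?I. (-1) ^ nat \<bar>j\<bar> * q ^ pentagonal j)" for q :: "int fps"
  have "fps_cong 3 (Suc n) (S fps_X) (euler_prod fps_X n)"
    unfolding S_def by (intro fps_cong_if_X_power_dvd euler_prod_pentagonal)
  moreover have "fps_cong 3 (Suc n) (S (fps_X ^ 3)) (euler_prod (fps_X ^ 3) n)"
  proof (rule fps_cong_if_X_power_dvd)
    have "(fps_X :: int fps) ^ Suc n dvd (fps_X ^ 3) ^ Suc n"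
      unfolding power_mult[symmetric] by (rule le_imp_power_dvd) simp
    thus "fps_X ^ Suc n dvd S (fps_X ^ 3) - euler_prod (fps_X ^ 3) n"
      unfolding S_def using euler_prod_pentagonal dvd_trans by blast
  qed
  ultimately have "fps_cong 3 (Suc n) (S fps_X * S (fps_X ^ 3)) (euler_prod fps_X n * euler_prod (fps_X ^ 3) n)"
    by (rule fps_cong_mult)
  hence "[int (B3 n) = fps_nth (S fps_X * S (fps_X ^ 3)) n] (mod 3)"
    using B3_cong_euler_prod[of n n] unfolding fps_cong_def by (meson cong_sym cong_trans lessI order_refl)
  also have "S fps_X * S (fps_X ^ 3)
      = (\<Sum>(i, j)\<in>?I \<times> ?I. fps_const ((-1) ^ nat \<bar>i\<bar> * (-1) ^ nat \<bar>j\<bar>) * fps_X ^ (pentagonal i + 3 * pentagonal j))"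
    unfolding S_def sum_product sum.cartesian_product
    by (intro sum.cong refl) (auto simp: power_add power_mult fps_const_mult[symmetric]
          fps_const_power[symmetric] fps_const_neg[symmetric] simp del: fps_const_mult fps_const_power fps_const_neg)
  also have "fps_nth \<dots> n
      = (\<Sum>(i, j)\<in>?I \<times> ?I. if pentagonal i + 3 * pentagonal j = n then (-1) ^ nat \<bar>i\<bar> * (-1) ^ nat \<bar>j\<bar> else 0)"
    unfolding fps_sum_nth by (intro sum.cong refl) (auto simp: fps_X_power_nth)
  also have "\<dots> = (\<Sum>(i, j)\<in>sum_of_pentagonals n. (-1) ^ nat \<bar>i\<bar> * (-1) ^ nat \<bar>j\<bar>)"
  proof (rule sum.mono_neutral_cong_right)
    \<comment> \<open>No representation of \<open>n\<close> lies outside the box, so the truncated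
      sums miss none.\<close>
    show "sum_of_pentagonals n \<subseteq> ?I \<times> ?I"
    proof clarify
      fix i j assume "(i, j) \<in> sum_of_pentagonals n"
      hence "pentagonal i + 3 * pentagonal j = n" by (simp add: sum_of_pentagonals_def)
      thus "i \<in> ?I \<and> j \<in> ?I"
        using abs_le_pentagonal[of i] abs_le_pentagonal[of j] by auto
    qed
  qed (auto simp: sum_of_pentagonals_def split: if_splits)
  finally show ?thesis .
qed

section \<open>The form \<open>x\<^sup>2 + 3 y\<^sup>2\<close> at primes \<open>p \<equiv> 5 (mod 6)\<close>\<close>

text \<open>With \<open>a = x - y\<close> and \<open>b = 2 y\<close> the form becomes \<open>a\<^sup>2 + a b + b\<^sup>2\<close>, a divisor of
  \<open>a\<^sup>3 - b\<^sup>3\<close>, and cubing is injective modulo \<open>p\<close> because \<open>p \<equiv> 2 (mod 3)\<close>.\<close>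

lemma prime_dvd_x2_3y2:
  fixes x y :: int and p :: nat
  assumes "prime p" "p mod 6 = 5" "int p dvd x\<^sup>2 + 3 * y\<^sup>2"
  shows "int p dvd x" "int p dvd y"
proof -
  have p: "prime (int p)" using assms(1) by simp
  have coprime_p: "\<not> int p dvd k" if "0 < k" "k < 5" for k :: int
    using zdvd_imp_le[of "int p" k] that assms(2) by (cases "p < 5") auto
  define a b where "a = x - y" and "b = 2 * y"
  have eq: "x\<^sup>2 + 3 * y\<^sup>2 = a\<^sup>2 + a * b + b\<^sup>2"
    by (simp add: a_def b_def power2_eq_square algebra_simps)
  have "int p dvd b"
  proof (rule ccontr)
    assume nb: "\<not> int p dvd b"
    have na: "\<not> int p dvd a"
    proof
      assume "int p dvd a"
      hence "int p dvd a\<^sup>2 + a * b" by (simp add: power2_eq_square)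
      hence "int p dvd b\<^sup>2" using assms(3) unfolding eq by (simp add: dvd_add_right_iff)
      thus False using nb p by (metis prime_dvd_power)
    qed
    have fermat: "[c ^ (p - 1) = 1] (mod int p)" if "\<not> int p dvd c" for c
    proof -
      have "coprime c (int p)" using that p by (metis coprime_commute prime_imp_coprime)
      hence "[c ^ totient (nat (int p)) = 1] (mod int p)"
        using prime_gt_1_nat[OF assms(1)] residues.euler_theorem[of "int p" c] by (simp add: residues_def)
      thus ?thesis using assms(1) by (simp add: totient_prime)
    qed
    have "a ^ 3 - b ^ 3 = (a - b) * (a\<^sup>2 + a * b + b\<^sup>2)"
      by (simp add: power3_eq_cube power2_eq_square algebra_simps)
    hence cube: "[a ^ 3 = b ^ 3] (mod int p)"
      using assms(3) unfolding eq by (simp add: cong_iff_dvd_diff)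
    \<comment> \<open>Here \<open>p\<close> being 2 modulo 3 enters: since \<open>p - 1\<close> is 1
      modulo 3, Fermat and equality of the cubes force \<open>a\<close> and \<open>b\<close> to
      agree modulo \<open>p\<close>.\<close>
    have "p - 1 = 3 * (p div 3) + 1" using assms(2) by presburger
    then obtain m where m: "p - 1 = 3 * m + 1" by blast
    have "[b ^ (p - 1) = a ^ (p - 1)] (mod int p)"
      using fermat[OF na] fermat[OF nb] by (metis cong_sym cong_trans)
    also have "a ^ (p - 1) = (a ^ 3) ^ m * a" unfolding m by (simp add: power_mult)
    also have "[(a ^ 3) ^ m * a = (b ^ 3) ^ m * a] (mod int p)"
      by (intro cong_mult cong_pow cube cong_refl)
    also have "b ^ (p - 1) = (b ^ 3) ^ m * b" unfolding m by (simp add: power_mult)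
    finally have "[(b ^ 3) ^ m * b = (b ^ 3) ^ m * a] (mod int p)" .
    hence "int p dvd (b ^ 3) ^ m * (b - a)"
      by (simp add: cong_iff_dvd_diff right_diff_distrib)
    hence "int p dvd b - a"
      using nb p by (metis prime_dvd_mult_iff prime_dvd_power)
    \<comment> \<open>For \<open>a\<close> congruent to \<open>b\<close> the form collapses to three
      times the square of \<open>b\<close>.\<close>
    moreover have "3 * b\<^sup>2 = (a\<^sup>2 + a * b + b\<^sup>2) + (b - a) * (a + 2 * b)"
      by (simp add: power2_eq_square algebra_simps)
    ultimately have "int p dvd 3 * b\<^sup>2" using assms(3) unfolding eq by (metis dvd_add dvd_mult2)
    thus False using nb p coprime_p[of 3] prime_dvd_power[of "int p" b 2] by (auto simp: prime_dvd_mult_iff)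
  qed
  thus y: "int p dvd y"
    using p coprime_p[of 2] by (auto simp: b_def prime_dvd_mult_iff)
  hence "int p dvd 3 * y\<^sup>2" by (simp add: power2_eq_square)
  hence "int p dvd x\<^sup>2" using assms(3) by (simp add: dvd_add_left_iff)
  thus "int p dvd x" using p by (metis prime_dvd_power)
qed

text \<open>Writing \<open>p = 6 m - 1\<close>, the map below is \<open>x \<mapsto> - p x\<close> in terms of \<open>x = 6 i - 1\<close>.\<close>

definition scale_index :: "int \<Rightarrow> int \<Rightarrow> int" where
  "scale_index m i = i + m - 6 * m * i"

lemma scale_index_eq: "6 * scale_index m i - 1 = - (6 * m - 1) * (6 * i - 1)"
  by (simp add: scale_index_def algebra_simps)

text \<open>The term \<open>6 * m * i\<close> is even, so the sign changes by a factor independent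
  of \<open>i\<close>.\<close>

lemma sign_scale_index: "(-1 :: int) ^ nat \<bar>scale_index m i\<bar> = (-1) ^ nat \<bar>m\<bar> * (-1) ^ nat \<bar>i\<bar>"
  by (auto simp: scale_index_def minus_one_power_iff even_nat_iff)

text \<open>Modulo 6 the cofactor must be 1, say \<open>6 * u + 1\<close>; its negative is
  \<open>6 * (- u) - 1\<close>, whence the index \<open>- u\<close>.\<close>

lemma scale_index_if_dvd:
  assumes "(6 * m - 1) dvd (6 * i - 1 :: int)"
  obtains i' where "i = scale_index m i'"
proof -
  obtain t where t: "6 * i - 1 = (6 * m - 1) * t" using assms by (rule dvdE)
  hence "t = 6 * (m * t - i) + 1" by (simp add: algebra_simps)
  then obtain u where "t = 6 * u + 1" by blast
  hence "i = scale_index m (- u)" using t by (simp add: scale_index_def algebra_simps)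
  thus ?thesis using that by blast
qed

lemma B3_cong_step:
  assumes "prime p" "p mod 6 = 5"
  shows "[int (B3 (p\<^sup>2 * n + (p\<^sup>2 - 1) div 6)) = int (B3 n)] (mod 3)"
proof -
  define m where "m = int (p div 6 + 1)"
  have p_eq: "int p = 6 * m - 1"
    using assms(2) unfolding m_def by presburger
  define N where "N = p\<^sup>2 * n + (p\<^sup>2 - 1) div 6"
  \<comment> \<open>The division by 6 is exact, and 4 (p^2 - 1) + 4 = 4 p^2 lets p^2 factor out of
    \<open>24 * N + 4\<close>.\<close>
  have "p\<^sup>2 mod 6 = 1" using assms(2) by (simp add: power_mod[symmetric])
  hence "6 * ((p\<^sup>2 - 1) div 6) + 1 = p\<^sup>2" by presburger
  hence "24 * N + 4 = p\<^sup>2 * (24 * n + 4)" by (simp add: N_def algebra_simps)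
  hence "int (24 * N + 4) = int (p\<^sup>2 * (24 * n + 4))" by (rule arg_cong)
  hence N: "24 * int N + 4 = (int p)\<^sup>2 * (24 * int n + 4)" by simp
  let ?h = "map_prod (scale_index m) (scale_index m)"
  have p0: "int p \<noteq> 0" using assms(1) by (auto simp: prime_gt_0_nat)
  have inj: "inj (scale_index m)"
  proof (rule injI)
    fix i j assume "scale_index m i = scale_index m j"
    hence "- int p * (6 * i - 1) = - int p * (6 * j - 1)"
      unfolding p_eq scale_index_eq[symmetric] by simp
    thus "i = j" using p0 by simp
  qed
  have iff: "?h z \<in> sum_of_pentagonals N \<longleftrightarrow> z \<in> sum_of_pentagonals n" for z
  proof -
    obtain i j where z: "z = (i, j)" by fastforce
    have "(6 * scale_index m i - 1)\<^sup>2 + 3 * (6 * scale_index m j - 1)\<^sup>2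
        = (int p)\<^sup>2 * ((6 * i - 1)\<^sup>2 + 3 * (6 * j - 1)\<^sup>2)"
      unfolding scale_index_eq p_eq[symmetric] power_mult_distrib power2_minus
      by (simp add: distrib_left)
    thus ?thesis using p0 by (simp add: z sum_of_pentagonals_iff N)
  qed
  have "sum_of_pentagonals N = ?h ` sum_of_pentagonals n"
  proof (intro equalityI subsetI)
    fix z assume z: "z \<in> sum_of_pentagonals N"
    obtain i j where ij: "z = (i, j)" by fastforce
    have "int p dvd (6 * i - 1)\<^sup>2 + 3 * (6 * j - 1)\<^sup>2"
      using z unfolding ij sum_of_pentagonals_iff N by (simp add: power2_eq_square)
    note dvd = prime_dvd_x2_3y2[OF assms this, unfolded p_eq]
    obtain i' where "i = scale_index m i'" using dvd(1) by (rule scale_index_if_dvd)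
    moreover obtain j' where "j = scale_index m j'" using dvd(2) by (rule scale_index_if_dvd)
    ultimately have "z = ?h (i', j')" using ij by simp
    thus "z \<in> ?h ` sum_of_pentagonals n" using z iff by blast
  qed (use iff in auto)
  hence "(\<Sum>(i, j)\<in>sum_of_pentagonals N. (-1) ^ nat \<bar>i\<bar> * (-1 :: int) ^ nat \<bar>j\<bar>)
      = (\<Sum>(i, j)\<in>sum_of_pentagonals n. (-1) ^ nat \<bar>scale_index m i\<bar> * (-1) ^ nat \<bar>scale_index m j\<bar>)"
    using inj by (simp add: sum.reindex inj_on_subset[OF prod.inj_map] case_prod_beta)
  \<comment> \<open>The factor \<open>(-1) ^ nat \<bar>m\<bar>\<close> occurs once for each
    coordinate and so cancels.\<close>
  also have "\<dots> = (\<Sum>(i, j)\<in>sum_of_pentagonals n. (-1) ^ nat \<bar>i\<bar> * (-1) ^ nat \<bar>j\<bar>)"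
    unfolding sign_scale_index by (intro sum.cong refl) (auto simp: minus_one_power_iff)
  finally have "[int (B3 N) = int (B3 n)] (mod 3)"
    using B3_cong_sum[of N] B3_cong_sum[of n] by (simp add: cong_def)
  thus ?thesis unfolding N_def .
qed

theorem corollary1p7:
  fixes k p n :: nat
  assumes "k > 0" and "prime p" and "[p = 5] (mod 6)"
  shows "[int (B3 (p ^ (2 * k) * n + (p ^ (2 * k) - 1) div 6)) = (- int p) ^ k * int (B3 n)] (mod 3)"
proof -
  have p: "p mod 6 = 5" using assms(3) by (simp add: cong_def)
  have sq: "p\<^sup>2 mod 6 = 1" using p by (simp add: power_mod[symmetric])
  have "[int (B3 (p ^ (2 * k) * n + (p ^ (2 * k) - 1) div 6)) = int (B3 n)] (mod 3)"
  proof (induction k)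
    case (Suc k)
    \<comment> \<open>Writing \<open>a\<close> and the square of \<open>p\<close> as
      \<open>6 * b + 1\<close> and \<open>6 * c + 1\<close> removes the floor divisions; the
      composed index map then becomes a polynomial identity.\<close>
    define a where "a = p ^ (2 * k)"
    define b where "b = a div 6"
    define c where "c = p\<^sup>2 div 6"
    have "a mod 6 = 1"
      unfolding a_def power_mult using sq by (simp add: power_mod[of "p\<^sup>2" 6, symmetric])
    hence b: "a = 6 * b + 1" unfolding b_def by presburger
    have c: "p\<^sup>2 = 6 * c + 1"
      unfolding c_def using mult_div_mod_eq[of 6 "p\<^sup>2"] sq by simp
    have p_Suc: "p ^ (2 * Suc k) = (6 * c + 1) * (6 * b + 1)"
      unfolding b[symmetric] c[symmetric] a_def by (simp add: power_add[symmetric])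
    have "(6 * c + 1) * (6 * b + 1) - 1 = 6 * (6 * c * b + b + c)"
      by (simp add: algebra_simps)
    hence "((6 * c + 1) * (6 * b + 1) - 1) div 6 = 6 * c * b + b + c" by simp
    hence "p ^ (2 * Suc k) * n + (p ^ (2 * Suc k) - 1) div 6
        = p\<^sup>2 * (a * n + (a - 1) div 6) + (p\<^sup>2 - 1) div 6"
      unfolding p_Suc b c by (simp add: algebra_simps)
    moreover have "[int (B3 (p\<^sup>2 * (a * n + (a - 1) div 6) + (p\<^sup>2 - 1) div 6)) = int (B3 n)] (mod 3)"
      using B3_cong_step[OF assms(2) p] Suc.IH unfolding a_def by (rule cong_trans)
    ultimately show ?case by (simp only:)
  qed simp
  moreover have "[(- int p) ^ k = 1 ^ k] (mod 3)"
  proof (rule cong_pow)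
    have "int p = 6 * int (p div 6) + 5" using p by presburger
    hence "- int p - 1 = 3 * (- 2 * int (p div 6) - 2)" by simp
    thus "[- int p = 1] (mod 3)" unfolding cong_iff_dvd_diff by (rule dvdI)
  qed
  hence "[int (B3 n) = (- int p) ^ k * int (B3 n)] (mod 3)"
    using cong_scalar_right[of "(- int p) ^ k" 1 3 "int (B3 n)"] by (simp add: cong_sym)
  ultimately show ?thesis by (rule cong_trans)
qed

end
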